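(* Let $D'$ be the planar network described below, and for $n,k\ge0$ let $T(n,k)=\sum_{\mathcal{P}\in\mathsf{P}_{n,k}}w(\mathcal{P})$. Apply the specialisations $e_{i,l}\to e$ for all $i,l$, $a_{i,0,l}\to c$ for all $i,l$, and $a_{i,j,l}\to a$ for all $j>0$, where $a,c,e$ are indeterminates. Then the resulting matrix $(T(n,k))_{n,k\ge0}$ coincides with the matrix $\mathbf{T}(a,c,0,e)$ defined by $T(0,k)=\delta_{k0}$ and, for $n\ge1$, $T(n,k)=[a(n-k)+c]\,T(n-1,k-1)+e\,T(n-1,k)$ (with $T(n,k)=0$ for $k<0$).
   Context: Let $\Delta(n)=\binom{n+1}{2}$ for $n\ge0$ (triangular numbers); for a triangular number $t$, $\Delta^{-1}(t)$ is the unique $n\ge0$ with $\Delta(n)=t$. For an integer $m\ge0$, let $\lceil m\rceil_\Delta$ be the smallest triangular number $\ge m$ and $\delta(m)=\lceil m\rceil_\Delta-m$. Let $\mathcal{A}=\{a_{i,j,l}:(i,j,l)\in\mathbb{N}^3,\ j\le i\}$ and $\mathcal{E}=\{e_{i,l}:(i,l)\in\mathbb{N}^2\}$ be sets of commuting indeterminates. Consider the digraph with vertex set $\{(i,j)\in\mathbb{Z}^2:0\le i\le j\}$ where, for $1\le i\le j$, there is a horizontal edge $(i,j)\to(i-1,j)$ of weight $\alpha_{i,j-i+1}$ and a diagonal edge $(i,j)\to(i-1,j-1)$ of weight $\beta_{i,j-i}$. Here, for $i\ge1,l\ge0$: $\beta_{i,l}=e_{\Delta^{-1}(i+l-1)-l,\,l}$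 if $i+l-1$ is triangular and $i+l-1\ge\Delta(l)$; $\beta_{i,l}=1$ if $i+l-1$ is not triangular and $i+l-1\ge\Delta(l)$; $\beta_{i,l}=0$ otherwise. For $i,l\ge1$: $\alpha_{i,l}=a_{\Delta^{-1}(\lceil i+l-1\rceil_\Delta)-l,\ \delta(i+l-1),\ l-1}$ if $\Delta^{-1}(\lceil i+l-1\rceil_\Delta)-l\ge\delta(i+l-1)$; otherwise $\alpha_{i,l}=1$ if $i+l-1$ is triangular and $i+l-1<\Delta(l)$; and $\alpha_{i,l}=0$ in all other cases. Deleting all edges of weight $0$ gives $D'$. Sources are $u_n=(\Delta(n),\Delta(n))$ and sinks $v_k=(0,\Delta(k))$. The weight $w(\mathcal{P})$ of a path is the product of its edge weights, and $\mathsf{P}_{n,k}$ is the set of directed paths in $D'$ from $u_n$ to $v_k$. *)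

theory Defs
  imports "HOL-Library.Poly_Mapping" "Graph_Theory.Arc_Walk"
begin

section \<open>Triangular numbers\<close>

definition tri :: "nat \<Rightarrow> nat" where
  "tri n = (n + 1) choose 2"

definition triangular :: "nat \<Rightarrow> bool" where
  "triangular t \<longleftrightarrow> (\<exists>n. t = tri n)"

definition tri_inv :: "nat \<Rightarrow> nat" where
  "tri_inv t = (THE n. tri n = t)"

definition tri_ceil :: "nat \<Rightarrow> nat" where
  "tri_ceil m = (LEAST t. triangular t \<and> m \<le> t)"

definition tri_gap :: "nat \<Rightarrow> nat" where
  "tri_gap m = tri_ceil m - m"


section \<open>Polynomials with integer coefficients\<close>

text \<open>Polynomials in commuting indeterminates indexed by \<open>'v\<close>: finitely supported maps from
  monomials (finitely supported exponent maps) to integer coefficients.\<close>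

type_synonym 'v int_mpoly = "('v \<Rightarrow>\<^sub>0 nat) \<Rightarrow>\<^sub>0 int"

definition Var :: "'v \<Rightarrow> 'v int_mpoly" where
  "Var x = Poly_Mapping.single (Poly_Mapping.single x 1) 1"

text \<open>The image of a polynomial when each indeterminate \<open>x\<close> is replaced by \<open>\<sigma> x\<close>.\<close>

definition substitute :: "('v \<Rightarrow> 'r) \<Rightarrow> 'v int_mpoly \<Rightarrow> 'r::comm_ring_1" where
  "substitute \<sigma> p =
     (\<Sum>m\<in>Poly_Mapping.keys p.
        of_int (Poly_Mapping.lookup p m) *
        (\<Prod>x\<in>Poly_Mapping.keys m. \<sigma> x ^ Poly_Mapping.lookup m x))"

text \<open>\<open>A i j l\<close> and \<open>E i l\<close> index the indeterminates $a_{i,j,l}$ and $e_{i,l}$. The indices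
  \<open>A i j l\<close> with \<open>i < j\<close>, for which there is no $a_{i,j,l}$, never occur in the edge weights below.\<close>

datatype net_var = A nat nat nat | E nat nat


section \<open>The planar network\<close>

text \<open>Used for \<open>i \<ge> 1\<close>, \<open>l \<ge> 0\<close>.\<close>

definition beta :: "nat \<Rightarrow> nat \<Rightarrow> net_var int_mpoly" where
  "beta i l =
     (if triangular (i + l - 1) \<and> i + l - 1 \<ge> tri l then Var (E (tri_inv (i + l - 1) - l) l)
      else if \<not> triangular (i + l - 1) \<and> i + l - 1 \<ge> tri l then 1
      else 0)"

text \<open>Used for \<open>i, l \<ge> 1\<close>. The difference in the first condition may be negative, so the
  comparison is made in the integers; once it holds, the subtraction in the index is exact.\<close>

definition alpha :: "nat \<Rightarrow> nat \<Rightarrow> net_var int_mpoly" where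
  "alpha i l =
     (if int (tri_inv (tri_ceil (i + l - 1))) - int l \<ge> int (tri_gap (i + l - 1))
      then Var (A (tri_inv (tri_ceil (i + l - 1)) - l) (tri_gap (i + l - 1)) (l - 1))
      else if triangular (i + l - 1) \<and> i + l - 1 < tri l then 1
      else 0)"

text \<open>\<open>Horizontal i j\<close> is the edge from \<open>(i, j)\<close> to \<open>(i - 1, j)\<close>, and \<open>Diagonal i j\<close> is the edge
  from \<open>(i, j)\<close> to \<open>(i - 1, j - 1)\<close>; both exist for \<open>1 \<le> i \<le> j\<close>, so the subtractions are exact.\<close>

datatype net_arc = Horizontal nat nat | Diagonal nat nat

fun arc_tail :: "net_arc \<Rightarrow> nat \<times> nat" where
  "arc_tail (Horizontal i j) = (i, j)"
| "arc_tail (Diagonal i j) = (i, j)"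

fun arc_head :: "net_arc \<Rightarrow> nat \<times> nat" where
  "arc_head (Horizontal i j) = (i - 1, j)"
| "arc_head (Diagonal i j) = (i - 1, j - 1)"

fun arc_weight :: "net_arc \<Rightarrow> net_var int_mpoly" where
  "arc_weight (Horizontal i j) = alpha i (j - i + 1)"
| "arc_weight (Diagonal i j) = beta i (j - i)"

definition network :: "(nat \<times> nat, net_arc) pre_digraph" where
  "network =
     \<lparr>verts = {(i, j). i \<le> j},
      arcs = {Horizontal i j | i j. 1 \<le> i \<and> i \<le> j} \<union> {Diagonal i j | i j. 1 \<le> i \<and> i \<le> j},
      tail = arc_tail,
      head = arc_head\<rparr>"

definition network' :: "(nat \<times> nat, net_arc) pre_digraph" where
  "network' = network\<lparr>arcs := {x \<in> arcs network. arc_weight x \<noteq> 0}\<rparr>"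

definition source :: "nat \<Rightarrow> nat \<times> nat" where
  "source n = (tri n, tri n)"

definition sink :: "nat \<Rightarrow> nat \<times> nat" where
  "sink k = (0, tri k)"

definition net_paths :: "nat \<Rightarrow> nat \<Rightarrow> net_arc list set" where
  "net_paths n k = {p. pre_digraph.apath network' (source n) p (sink k)}"

definition path_weight :: "net_arc list \<Rightarrow> net_var int_mpoly" where
  "path_weight p = prod_list (map arc_weight p)"

text \<open>The first coordinate drops by one along every edge, so the sum is finite.\<close>

definition path_matrix :: "nat \<Rightarrow> nat \<Rightarrow> net_var int_mpoly" where
  "path_matrix n k = (\<Sum>p\<in>net_paths n k. path_weight p)"


section \<open>The specialisation and the recurrence\<close>

datatype spec_var = SA | SC | SE

definition a_ind :: "spec_var int_mpoly" where "a_ind = Var SA"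
definition c_ind :: "spec_var int_mpoly" where "c_ind = Var SC"
definition e_ind :: "spec_var int_mpoly" where "e_ind = Var SE"

fun spec_image :: "net_var \<Rightarrow> spec_var int_mpoly" where
  "spec_image (E i l) = e_ind"
| "spec_image (A i j l) = (if j = 0 then c_ind else a_ind)"

definition specialise :: "net_var int_mpoly \<Rightarrow> spec_var int_mpoly" where
  "specialise = substitute spec_image"

text \<open>The matrix $\mathbf{T}(a,c,0,e)$; the column index is an integer so that the boundary
  condition \<open>T(n,k) = 0\<close> for \<open>k < 0\<close> and the coefficient \<open>n - k\<close> can be written literally.\<close>

fun rec_matrix :: "'r \<Rightarrow> 'r \<Rightarrow> 'r \<Rightarrow> nat \<Rightarrow> int \<Rightarrow> 'r::comm_ring_1" where
  "rec_matrix a c e 0 k = (if k = 0 then 1 else 0)"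
| "rec_matrix a c e (Suc n) k =
     (if k < 0 then 0
      else (a * of_int (int (Suc n) - k) + c) * rec_matrix a c e n (k - 1)
           + e * rec_matrix a c e n k)"

end

theory Submission
  imports Defs
begin

text \<open>Both matrices have the entries $e^{n-k} h_k(c, c+a, \ldots, c+(n-k)a)$ for $k \le n$ and
  $0$ otherwise. For the recurrence this is the identity that splits off the last variable of $h_k$.
  In the network, write $d = j - i$ and cut along the rows $j = \Delta(N)$. In the strip above row
  $\Delta(N-1)$ the specialised weights depend only on $d$ and the row: row $\Delta(N)$ allows any
  number of horizontal steps of weight $c$ up to $d = N$, row $\Delta(N-1)+p$ with $p < N$ allows
  steps of weight $a$ while $d < p$, and the diagonal step into row $\Delta(N-1)$ has weight $e$.
  The steps of weight $a$ turn $h_m(c, \ldots, c+(r-1)a)$ into $h_m(c+a, \ldots, c+ra)$,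
  and those of weight $c$ then restore the first variable.\<close>

section \<open>Substitution is a ring homomorphism\<close>

definition monom_value :: "('v \<Rightarrow> 'r::comm_ring_1) \<Rightarrow> ('v \<Rightarrow>\<^sub>0 nat) \<Rightarrow> 'r" where
  "monom_value \<sigma> m = (\<Prod>x\<in>Poly_Mapping.keys m. \<sigma> x ^ Poly_Mapping.lookup m x)"

lemma monom_value_superset:
  assumes "finite S" "Poly_Mapping.keys m \<subseteq> S"
  shows "monom_value \<sigma> m = (\<Prod>x\<in>S. \<sigma> x ^ Poly_Mapping.lookup m x)"
  unfolding monom_value_def
  by (rule prod.mono_neutral_left) (use assms in \<open>auto simp: in_keys_iff\<close>)

lemma monom_value_0 [simp]: "monom_value \<sigma> 0 = 1"
  by (simp add: monom_value_def)

lemma monom_value_add: "monom_value \<sigma> (m + n) = monom_value \<sigma> m * monom_value \<sigma> n"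
proof -
  let ?S = "Poly_Mapping.keys m \<union> Poly_Mapping.keys n"
  have "finite ?S" by simp
  then show ?thesis
    by (subst (1 2 3) monom_value_superset[of ?S])
       (use keys_add[of m n] in \<open>auto simp: lookup_add power_add prod.distrib\<close>)
qed

lemma substitute_monom_value:
  "substitute \<sigma> p = (\<Sum>m\<in>Poly_Mapping.keys p. of_int (Poly_Mapping.lookup p m) * monom_value \<sigma> m)"
  by (simp add: substitute_def monom_value_def)

lemma substitute_0 [simp]: "substitute \<sigma> 0 = 0"
  by (simp add: substitute_def)

lemma substitute_add: "substitute \<sigma> (p + q) = substitute \<sigma> p + substitute \<sigma> q"
  unfolding substitute_monom_value
  by (rule setsum_keys_plus_distrib) (auto simp: algebra_simps)

lemma substitute_diff: "substitute \<sigma> (p - q) = substitute \<sigma> p - substitute \<sigma> q"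
  by (metis add_diff_cancel_right' diff_add_cancel substitute_add)

lemma substitute_sum: "substitute \<sigma> (\<Sum>x\<in>S. f x) = (\<Sum>x\<in>S. substitute \<sigma> (f x))"
  by (induction S rule: infinite_finite_induct) (auto simp: substitute_add)

lemma substitute_single: "substitute \<sigma> (Poly_Mapping.single m 1) = monom_value \<sigma> m"
  by (simp add: substitute_monom_value)

lemma substitute_1 [simp]: "substitute \<sigma> 1 = 1"
  using substitute_single[of \<sigma> 0] by simp

lemma substitute_Var [simp]: "substitute \<sigma> (Var x) = \<sigma> x"
  by (simp add: Var_def substitute_single monom_value_def)

text \<open>Polynomials form the free abelian group on the monomials, so
  \<open>frag_induction\<close> reduces both factors in turn to single monomials. It closes under
  differences, whence \<open>substitute_diff\<close>.\<close>

lemma substitute_mult: "substitute \<sigma> (p * q) = substitute \<sigma> p * substitute \<sigma> q"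
proof -
  have single: "substitute \<sigma> (Poly_Mapping.single m 1 * q) =
      monom_value \<sigma> m * substitute \<sigma> q" for m
    using order.refl[of "Poly_Mapping.keys q"]
    by (induction q rule: frag_induction)
       (simp_all add: mult_single substitute_single monom_value_add substitute_diff
          right_diff_distrib)
  show ?thesis
    using order.refl[of "Poly_Mapping.keys p"]
    by (induction p rule: frag_induction)
       (simp_all add: single substitute_single substitute_diff left_diff_distrib)
qed

lemma substitute_prod_list: "substitute \<sigma> (prod_list xs) = prod_list (map (substitute \<sigma>) xs)"
  by (induction xs) (auto simp: substitute_mult)


section \<open>Complete homogeneous polynomials of an arithmetic progression\<close>

text \<open>\<open>hom_prog a x r m\<close> is $h_m(x, x+a, \ldots, x+(r-1)a)$.\<close>

fun hom_prog :: "'r \<Rightarrow> 'r \<Rightarrow> nat \<Rightarrow> nat \<Rightarrow> 'r::comm_ring_1" where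
  "hom_prog a x r 0 = 1"
| "hom_prog a x 0 (Suc m) = 0"
| "hom_prog a x (Suc r) (Suc m) = x * hom_prog a x (Suc r) m + hom_prog a (x + a) r (Suc m)"

lemma hom_prog_one: "hom_prog a x (Suc 0) m = x ^ m"
  by (induction m) auto

text \<open>The definition splits off the first variable. Splitting off the last as well, by
  induction on \<open>r\<close> (for the progression from \<open>x + a\<close>) and on
  \<open>m\<close>, leaves terms that recombine at the first variable.\<close>

lemma hom_prog_last:
  "hom_prog a x (Suc r) (Suc m) =
     (x + of_nat r * a) * hom_prog a x (Suc r) m + hom_prog a x r (Suc m)"
proof (induction r arbitrary: x m)
  case 0
  then show ?case by simp
next
  case (Suc r)
  show ?case
  proof (induction m)
    case 0
    then show ?case using Suc[of "x + a" 0] by (simp add: algebra_simps)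
  next
    case m: (Suc m)
    have "hom_prog a x (Suc (Suc r)) (Suc (Suc m)) =
        x * hom_prog a x (Suc (Suc r)) (Suc m) + hom_prog a (x + a) (Suc r) (Suc (Suc m))"
      by simp
    also have "hom_prog a (x + a) (Suc r) (Suc (Suc m)) =
        (x + a + of_nat r * a) * hom_prog a (x + a) (Suc r) (Suc m) +
        hom_prog a (x + a) r (Suc (Suc m))"
      by (rule Suc)
    also have "x * hom_prog a x (Suc (Suc r)) (Suc m) =
        x * ((x + of_nat (Suc r) * a) * hom_prog a x (Suc (Suc r)) m + hom_prog a x (Suc r) (Suc m))"
      by (simp only: m)
    finally show ?case by (simp add: algebra_simps)
  qed
qed

text \<open>\<open>strip_sum a x r q m\<close> is the coefficient of $t^m$ in
  $(1 + at)^q \sum_m h_m(x, \ldots, x+(r-1)a) t^m$.\<close>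

definition strip_sum :: "'r \<Rightarrow> 'r \<Rightarrow> nat \<Rightarrow> nat \<Rightarrow> nat \<Rightarrow> 'r::comm_ring_1" where
  "strip_sum a x r q m = (\<Sum>j\<le>m. of_nat (q choose j) * a ^ j * hom_prog a x r (m - j))"

lemma strip_sum_0 [simp]: "strip_sum a x r q 0 = 1"
  by (simp add: strip_sum_def)

lemma strip_sum_no_rows [simp]: "strip_sum a x r 0 m = hom_prog a x r m"
  by (simp add: strip_sum_def sum.atMost_shift)

text \<open>One more factor \<open>1 + a t\<close>, by Pascal's rule.\<close>

lemma strip_sum_Suc:
  "strip_sum a x r (Suc q) (Suc m) = a * strip_sum a x r q m + strip_sum a x r q (Suc m)"
  unfolding strip_sum_def sum.atMost_Suc_shift
  by (simp add: sum_distrib_left sum.distrib algebra_simps)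

text \<open>Split off the last shifted variable, \<open>a + (x + r a)\<close>. Both induction
  hypotheses carry the same binomial exponent; the part \<open>x + r a\<close> restores the last
  unshifted variable, and the part \<open>a\<close> raises the exponent by one.\<close>

lemma hom_prog_shift: "hom_prog a (x + a) r m = strip_sum a x r (m + r - 1) m"
proof (induction r arbitrary: m)
  case 0
  show ?case
  proof (cases m)
    case (Suc n)
    \<comment> \<open>Without variables only \<open>j = Suc n\<close> could contribute, and there
      the binomial coefficient vanishes.\<close>
    have "of_nat (n choose j) * a ^ j * hom_prog a x 0 (Suc n - j) = 0" if "j \<le> Suc n" for j
      using that by (cases "j = Suc n") (auto simp: Suc_diff_le binomial_eq_0)
    then show ?thesis
      unfolding Suc strip_sum_def by (simp del: sum.atMost_Suc add: Suc_diff_le)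
  qed simp
next
  case r: (Suc r)
  show ?case
  proof (induction m)
    case 0
    then show ?case by simp
  next
    case (Suc m)
    let ?h = "hom_prog a x"
    have last: "(x + of_nat r * a) * ?h (Suc r) (m - j) + ?h r (Suc m - j) = ?h (Suc r) (Suc m - j)"
      if "j \<le> m" for j
      using that hom_prog_last[of a x r "m - j"] by (simp add: Suc_diff_le)
    \<comment> \<open>The term \<open>j = Suc m\<close> stands apart: it contains
      \<open>h_0 = 1\<close> whatever the number of variables.\<close>
    have "(x + of_nat r * a) * strip_sum a x (Suc r) (m + r) m + strip_sum a x r (m + r) (Suc m) =
        (\<Sum>j\<le>m. of_nat (m + r choose j) * a ^ j *
          ((x + of_nat r * a) * ?h (Suc r) (m - j) + ?h r (Suc m - j))) +
        of_nat (m + r choose Suc m) * a ^ Suc m"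
      by (simp add: strip_sum_def sum_distrib_left sum.distrib algebra_simps)
    also have "\<dots> = strip_sum a x (Suc r) (m + r) (Suc m)"
      unfolding strip_sum_def by (simp add: last del: hom_prog.simps(3))
    finally have *: "(x + of_nat r * a) * strip_sum a x (Suc r) (m + r) m +
        strip_sum a x r (m + r) (Suc m) = strip_sum a x (Suc r) (m + r) (Suc m)" .
    have "hom_prog a (x + a) (Suc r) (Suc m) =
        (x + a + of_nat r * a) * hom_prog a (x + a) (Suc r) m + hom_prog a (x + a) r (Suc m)"
      by (rule hom_prog_last)
    also have "\<dots> = a * strip_sum a x (Suc r) (m + r) m + strip_sum a x (Suc r) (m + r) (Suc m)"
      unfolding Suc r *[symmetric] by (simp add: algebra_simps)
    also have "\<dots> = strip_sum a x (Suc r) (Suc (m + r)) (Suc m)"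
      by (rule strip_sum_Suc[symmetric])
    finally show ?case by simp
  qed
qed

section \<open>Closed form of the recurrence matrix\<close>

text \<open>In column \<open>k > 0\<close>, at or below the diagonal, the coefficient
  \<open>a (n - k) + c\<close> of the recurrence is the last variable of the progression.\<close>

lemma rec_matrix_closed_form:
  "rec_matrix a c e n (int k) = (if k \<le> n then e ^ (n - k) * hom_prog a c (Suc (n - k)) k else 0)"
proof (induction n arbitrary: k)
  case 0
  then show ?case by (cases k) auto
next
  case (Suc n)
  show ?case
  proof (cases k)
    case 0
    have "rec_matrix a c e n (- 1) = 0" by (cases n) auto
    then show ?thesis using Suc[of 0] 0 by simp
  next
    case k: (Suc l)
    have IH: "rec_matrix a c e n (int k - 1) =
        (if l \<le> n then e ^ (n - l) * hom_prog a c (Suc (n - l)) l else 0)"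
      using Suc[of l] k by simp
    have step: "rec_matrix a c e (Suc n) (int k) =
        (a * of_int (int (Suc n) - int k) + c) * rec_matrix a c e n (int k - 1) +
        e * rec_matrix a c e n (int k)"
      by simp
    consider "l < n" | "l = n" | "l > n" by linarith
    then show ?thesis
    proof cases
      case 1
      then obtain r where r: "n = l + Suc r" using less_iff_Suc_add by auto
      have "rec_matrix a c e (Suc n) (int k) =
          (a * of_nat (Suc r) + c) * (e ^ Suc r * hom_prog a c (Suc (Suc r)) l) +
          e * (e ^ r * hom_prog a c (Suc r) (Suc l))"
        unfolding step IH Suc using r by (simp add: k del: hom_prog.simps)
      also have "\<dots> = e ^ Suc r * hom_prog a c (Suc (Suc r)) (Suc l)"
        by (simp add: hom_prog_last[of a c "Suc r"] algebra_simps del: hom_prog.simps of_nat_Suc)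
      finally show ?thesis using r k by simp
    next
      case 2
      then show ?thesis
        unfolding step IH Suc by (simp add: k)
    next
      case 3
      then show ?thesis
        unfolding step IH Suc by (simp add: k)
    qed
  qed
qed


section \<open>Edge weights along a strip between consecutive triangular numbers\<close>

lemma tri_0 [simp]: "tri 0 = 0"
  by (simp add: tri_def)

lemma tri_Suc [simp]: "tri (Suc n) = tri n + Suc n"
  by (simp add: tri_def numeral_2_eq_2)

lemma strict_mono_tri: "strict_mono tri"
  by (rule strict_mono_Suc_iff[THEN iffD2]) simp

lemmas tri_less_iff = strict_mono_less[OF strict_mono_tri]
lemmas tri_le_iff = strict_mono_less_eq[OF strict_mono_tri]
lemmas tri_eq_iff = strict_mono_eq[OF strict_mono_tri]

lemma le_tri: "n \<le> tri n"
  by (rule strict_mono_imp_increasing[OF strict_mono_tri])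

lemma tri_inv_tri [simp]: "tri_inv (tri n) = n"
  by (simp add: tri_inv_def tri_eq_iff)

lemma tri_between: "tri M < t \<Longrightarrow> triangular t \<Longrightarrow> tri (Suc M) \<le> t"
  by (auto simp: triangular_def tri_less_iff tri_le_iff Suc_le_eq simp del: tri_Suc)

context
  fixes M p :: nat
  assumes p: "1 \<le> p" "p \<le> Suc M"
begin

lemma tri_ceil_strip: "tri_ceil (tri M + p) = tri (Suc M)"
  unfolding tri_ceil_def
proof (rule Least_equality)
  show "triangular (tri (Suc M)) \<and> tri M + p \<le> tri (Suc M)"
    using p by (auto simp: triangular_def simp del: tri_Suc) simp
  show "tri (Suc M) \<le> t" if "triangular t \<and> tri M + p \<le> t" for t
    using that p by (intro tri_between) auto
qed

lemma tri_gap_strip: "tri_gap (tri M + p) = Suc M - p"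
  by (simp add: tri_gap_def tri_ceil_strip)

lemma triangular_strip: "triangular (tri M + p) \<longleftrightarrow> p = Suc M"
proof
  assume "triangular (tri M + p)"
  then have "tri (Suc M) \<le> tri M + p"
    using p by (intro tri_between) auto
  then show "p = Suc M" using p by simp
next
  assume "p = Suc M"
  then have "tri M + p = tri (Suc M)" by simp
  then show "triangular (tri M + p)" unfolding triangular_def by blast
qed

text \<open>For \<open>l = Suc d\<close> the quantity \<open>i + l - 1\<close> is the row itself, so
  the index condition becomes \<open>d < p\<close>, and the gap is 0 exactly in the triangular
  row.\<close>

lemma specialise_alpha_strip:
  assumes "1 \<le> i" "i + d = tri M + p"
  shows "specialise (alpha i (Suc d)) =
    (if d < p then (if p = Suc M then c_ind else a_ind) else if p = Suc M then 1 else 0)"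
proof -
  have index: "i + Suc d - 1 = tri M + p" using assms by simp
  have above: "tri M + p < tri (Suc d)" if "p = Suc M" "\<not> d < p"
    using that tri_less_iff[of "Suc M" "Suc d"] by simp
  show ?thesis
    unfolding alpha_def index tri_ceil_strip tri_gap_strip triangular_strip tri_inv_tri
    using p above by (auto simp: specialise_def)
qed

text \<open>Here \<open>i + l - 1\<close> is the row below, \<open>tri M + (p - 1)\<close>, which
  lies in the half-open interval from \<open>tri M\<close> to \<open>tri (Suc M)\<close>.\<close>

lemma specialise_beta_strip:
  assumes "1 \<le> i" "i + d = tri M + p"
  shows "specialise (beta i d) = (if d \<le> M then (if p = 1 then e_ind else 1) else 0)"
proof -
  have index: "i + d - 1 = tri M + (p - 1)" using assms p by simp
  have "triangular (tri M + (p - 1)) \<longleftrightarrow> p = 1"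
  proof (cases "p = 1")
    case False
    have "\<not> triangular (tri M + (p - 1))"
      using tri_between[of M "tri M + (p - 1)"] False p by fastforce
    then show ?thesis using False by simp
  qed (auto simp: triangular_def)
  moreover have "tri d \<le> tri M + (p - 1) \<longleftrightarrow> d \<le> M"
  proof (cases "d \<le> M")
    case True
    then show ?thesis using tri_le_iff[of d M] by simp
  next
    case False
    then show ?thesis using tri_le_iff[of "Suc M" d] p by simp
  qed
  ultimately show ?thesis
    unfolding beta_def index using p by (auto simp: specialise_def)
qed

end


section \<open>Path sums\<close>

interpretation net: wf_digraph network'
  by standard (auto simp: network'_def network_def)

lemma verts_network': "verts network' = {(i, j). i \<le> j}"
  and tail_network' [simp]: "tail network' = arc_tail"
  and head_network' [simp]: "head network' = arc_head"
  by (simp_all add: network'_def network_def)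

lemma arcs_network':
  "Horizontal i j \<in> arcs network' \<longleftrightarrow> 1 \<le> i \<and> i \<le> j \<and> alpha i (Suc (j - i)) \<noteq> 0"
  "Diagonal i j \<in> arcs network' \<longleftrightarrow> 1 \<le> i \<and> i \<le> j \<and> beta i (j - i) \<noteq> 0"
  by (auto simp: network'_def network_def)

lemma fst_arc_head_less: "x \<in> arcs network' \<Longrightarrow> fst (arc_head x) < fst (arc_tail x)"
  by (cases x) (auto simp: arcs_network')

lemma fst_awalk_verts_le:
  "net.awalk u p v \<Longrightarrow> w \<in> set (net.awalk_verts u p) \<Longrightarrow> fst w \<le> fst u"
proof (induction p arbitrary: u)
  case (Cons x p)
  then show ?case
    using fst_arc_head_less[of x] by (fastforce simp: net.awalk_Cons_iff)
qed simp

text \<open>The first coordinate drops along every arc, so no walk revisits a vertex and the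
  distinctness required by \<open>apath\<close> is automatic.\<close>

lemma apath_Cons:
  "net.apath u (x # p) v \<longleftrightarrow> x \<in> arcs network' \<and> arc_tail x = u \<and> net.apath (arc_head x) p v"
proof -
  have "arc_tail x \<notin> set (net.awalk_verts (arc_head x) p)"
    if "x \<in> arcs network'" "net.apath (arc_head x) p v"
    using fst_awalk_verts_le[of "arc_head x" p v "arc_tail x"] fst_arc_head_less[OF that(1)] that(2)
    by (auto simp: net.apath_def)
  then show ?thesis by (auto simp: net.apath_Cons_iff)
qed

abbreviation paths_from :: "nat \<Rightarrow> nat \<Rightarrow> nat \<Rightarrow> net_arc list set" where
  "paths_from k i j \<equiv> {p. net.apath (i, j) p (sink k)}"

lemma paths_from_0: "paths_from k 0 j = (if j = tri k then {[]} else {})"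
proof -
  have "net.apath (0, j) p (sink k) \<longleftrightarrow> p = [] \<and> j = tri k" for p
  proof (cases p)
    case Nil
    then show ?thesis by (auto simp: net.apath_Nil_iff sink_def verts_network')
  next
    case (Cons x q)
    then show ?thesis by (cases x) (auto simp: apath_Cons arcs_network')
  qed
  then show ?thesis by auto
qed

lemma paths_from_Suc:
  assumes "Suc i \<le> j"
  shows "paths_from k (Suc i) j =
    (if alpha (Suc i) (Suc (j - Suc i)) = 0 then {}
     else (#) (Horizontal (Suc i) j) ` paths_from k i j) \<union>
    (if beta (Suc i) (j - Suc i) = 0 then {}
     else (#) (Diagonal (Suc i) j) ` paths_from k i (j - 1))" (is "_ = ?R")
proof (rule set_eqI)
  fix p
  show "p \<in> paths_from k (Suc i) j \<longleftrightarrow> p \<in> ?R"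
  proof (cases p)
    case Nil
    then show ?thesis by (auto simp: net.apath_Nil_iff sink_def)
  next
    case (Cons x q)
    then show ?thesis using assms by (cases x) (auto simp: apath_Cons arcs_network')
  qed
qed

lemma finite_paths_from: "i \<le> j \<Longrightarrow> finite (paths_from k i j)"
proof (induction i arbitrary: j)
  case 0
  then show ?case by (simp add: paths_from_0)
next
  case (Suc i)
  then show ?case by (simp add: paths_from_Suc)
qed

section \<open>Specialised path sums and their recursion\<close>

definition path_sum :: "nat \<Rightarrow> nat \<Rightarrow> nat \<Rightarrow> spec_var int_mpoly" where
  "path_sum k i j = (\<Sum>p\<in>paths_from k i j. specialise (path_weight p))"

lemma specialise_path_matrix: "specialise (path_matrix n k) = path_sum k (tri n) (tri n)"
  by (simp add: path_matrix_def path_sum_def specialise_def substitute_sum net_paths_def source_def)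

lemma path_sum_0: "path_sum k 0 j = (if j = tri k then 1 else 0)"
  by (simp add: path_sum_def paths_from_0 path_weight_def specialise_def)

text \<open>Paths are sorted by their first arc. A deleted arc has weight 0, so its term vanishes
  just as its set of paths is empty.\<close>

lemma path_sum_Suc:
  assumes "Suc i \<le> j"
  shows "path_sum k (Suc i) j =
    specialise (alpha (Suc i) (Suc (j - Suc i))) * path_sum k i j +
    specialise (beta (Suc i) (j - Suc i)) * path_sum k i (j - 1)"
proof -
  let ?w = "\<lambda>p. specialise (path_weight p)"
  let ?H = "if alpha (Suc i) (Suc (j - Suc i)) = 0 then {}
     else (#) (Horizontal (Suc i) j) ` paths_from k i j"
  let ?D = "if beta (Suc i) (j - Suc i) = 0 then {}
     else (#) (Diagonal (Suc i) j) ` paths_from k i (j - 1)"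
  have "finite ?H" "finite ?D" "?H \<inter> ?D = {}"
    using assms by (auto simp: finite_paths_from)
  then have "sum ?w (?H \<union> ?D) = sum ?w ?H + sum ?w ?D"
    by (rule sum.union_disjoint)
  moreover have "sum ?w ?H = specialise (alpha (Suc i) (Suc (j - Suc i))) * path_sum k i j"
    by (auto simp: path_sum_def sum.reindex sum_distrib_left path_weight_def specialise_def
          substitute_mult)
  moreover have "sum ?w ?D = specialise (beta (Suc i) (j - Suc i)) * path_sum k i (j - 1)"
    by (auto simp: path_sum_def sum.reindex sum_distrib_left path_weight_def specialise_def
          substitute_mult)
  ultimately show ?thesis
    unfolding path_sum_def[of k "Suc i" j] paths_from_Suc[OF assms] by simp
qed

text \<open>The second coordinate never increases along an arc.\<close>

lemma path_sum_below: "i \<le> j \<Longrightarrow> j < tri k \<Longrightarrow> path_sum k i j = 0"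
  by (induction i arbitrary: j) (auto simp: path_sum_0 path_sum_Suc)

text \<open>A diagonal step would fall below the sink, so the only path is horizontal. Its steps
  weigh \<open>c\<close> while \<open>d < k\<close> and 1 afterwards, which the truncated exponent
  records.\<close>

lemma path_sum_at: "i \<le> tri k \<Longrightarrow> path_sum k i (tri k) = c_ind ^ (k - (tri k - i))"
proof (induction i)
  case 0
  then show ?case using le_tri[of k] by (simp add: path_sum_0)
next
  case (Suc i)
  define d where "d = tri k - Suc i"
  obtain M where M: "k = Suc M" using Suc.prems by (cases k) auto
  have d: "Suc i + d = tri M + Suc M" "tri k - i = Suc d"
    using Suc.prems M by (auto simp: d_def)
  have "path_sum k (Suc i) (tri k) =
      specialise (alpha (Suc i) (Suc d)) * c_ind ^ (k - Suc d)"
    using Suc d by (simp add: path_sum_Suc path_sum_below d_def)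
  also have "specialise (alpha (Suc i) (Suc d)) = (if d < k then c_ind else 1)"
    using specialise_alpha_strip[of "Suc M" M "Suc i" d] d M by simp
  also have "(if d < k then c_ind else 1) * c_ind ^ (k - Suc d) = c_ind ^ (k - d)"
    by (auto simp: Suc_diff_Suc simp flip: power_Suc)
  finally show ?case by (simp add: d_def)
qed

section \<open>Evaluation of path sums strip by strip\<close>

text \<open>The value at a vertex \<open>d\<close> steps off the diagonal and \<open>p\<close> rows above the triangular number
  \<open>tri M\<close>, apart from the power of \<open>e\<close>. A path that goes down to row \<open>tri M\<close> by
  making \<open>t\<close> horizontal steps can do so in \<open>p - d choose t\<close> ways.\<close>

definition strip_value :: "nat \<Rightarrow> nat \<Rightarrow> nat \<Rightarrow> nat \<Rightarrow> spec_var int_mpoly" where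
  "strip_value k r p d = (if d \<le> k then strip_sum a_ind c_ind r (p - d) (k - d) else 0)"

text \<open>The first arc is horizontal (\<open>d\<close> grows) or diagonal (\<open>p\<close>
  drops). For \<open>d > p\<close> both exponents truncate to 0.\<close>

lemma strip_value_Suc:
  "strip_value k r (Suc p) d =
     (if d \<le> p then a_ind * strip_value k r (Suc p) (Suc d) else 0) + strip_value k r p d"
proof (cases "d \<le> p \<and> d < k")
  case True
  then obtain m where "k - d = Suc m" "k - Suc d = m" "Suc p - d = Suc (p - d)"
    by (metis Suc_diff_Suc Suc_diff_le)
  then show ?thesis
    using True strip_sum_Suc[of a_ind c_ind r "p - d" m] by (simp add: strip_value_def)
qed (auto simp: strip_value_def)

text \<open>The value in a triangular row, apart from the power of \<open>e\<close>;
  \<open>r\<close> is the number of variables.\<close>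

definition top_value :: "nat \<Rightarrow> nat \<Rightarrow> nat \<Rightarrow> spec_var int_mpoly" where
  "top_value k r d = (if d \<le> k then hom_prog a_ind c_ind r (k - d) else 0)"

lemma strip_value_bottom: "strip_value k r 0 d = top_value k r d"
  by (simp add: strip_value_def top_value_def)

text \<open>The first variable \<open>c\<close> accounts for the horizontal step. The rest is the
  shifted progression, and the exponent in \<open>hom_prog_shift\<close>,
  \<open>(k - d) + (Suc M - k) - 1\<close>, is exactly the \<open>M - d\<close> of
  \<open>strip_value\<close>.\<close>

lemma top_value_Suc:
  assumes "k \<le> M"
  shows "top_value k (Suc (Suc M - k)) d =
    c_ind * top_value k (Suc (Suc M - k)) (Suc d) + strip_value k (Suc M - k) M d"
proof (cases "d < k")
  case True
  then obtain m where m: "k = d + Suc m" using less_iff_Suc_add by auto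
  then obtain r where r: "M = d + Suc m + r" using assms le_Suc_ex by blast
  have "M - d = m + Suc (Suc r) - 1" "Suc M - k = Suc r"
    using m r by auto
  then show ?thesis
    using m hom_prog_shift[of a_ind c_ind "Suc r" "Suc m"] r
    by (simp add: top_value_def strip_value_def)
qed (auto simp: top_value_def strip_value_def)

text \<open>Induction on the first coordinate, over all strips at once, since a diagonal step from
  \<open>p = 1\<close> enters the strip below. Each strip down to row \<open>tri k\<close>
  contributes one \<open>e\<close> and one variable.\<close>

lemma path_sum_strip:
  assumes "i + d = tri M + p" "1 \<le> p" "p \<le> Suc M" "k \<le> M"
  shows "path_sum k i (i + d) = e_ind ^ (Suc M - k) *
    (if p = Suc M then top_value k (Suc (Suc M - k)) d else strip_value k (Suc M - k) p d)"
  using assms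
proof (induction i arbitrary: d M p)
  case 0
  \<comment> \<open>The vertex is above row \<open>tri k\<close> and \<open>d > k\<close>, so both
    sides are 0.\<close>
  have "k \<le> tri k" "tri k \<le> tri M"
    using le_tri 0 by (auto simp: tri_le_iff)
  then show ?case
    using 0 by (simp add: path_sum_0 top_value_def strip_value_def)
next
  case (Suc i)
  note p = Suc.prems(2,3)
  let ?r = "Suc M - k"
  have steps: "path_sum k (Suc i) (Suc i + d) =
      specialise (alpha (Suc i) (Suc d)) * path_sum k i (i + Suc d) +
      specialise (beta (Suc i) d) * path_sum k i (i + d)"
    using path_sum_Suc[of i "Suc i + d" k] by simp
  have horizontal: "specialise (alpha (Suc i) (Suc d)) * path_sum k i (i + Suc d) = e_ind ^ ?r *
      (if p = Suc M then c_ind * top_value k (Suc ?r) (Suc d)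
       else if d < p then a_ind * strip_value k ?r p (Suc d) else 0)"
  proof -
    have "path_sum k i (i + Suc d) = e_ind ^ ?r *
        (if p = Suc M then top_value k (Suc ?r) (Suc d) else strip_value k ?r p (Suc d))"
      using Suc.prems by (intro Suc.IH) auto
    \<comment> \<open>Here the horizontal weight is 1 instead of \<open>c\<close>, but the value it
      multiplies is 0.\<close>
    moreover have "top_value k (Suc ?r) (Suc d) = 0" if "p = Suc M" "\<not> d < p"
      using that Suc.prems(4) by (simp add: top_value_def)
    ultimately show ?thesis
      using specialise_alpha_strip[OF p, of "Suc i" d] Suc.prems by simp
  qed
  have diagonal: "specialise (beta (Suc i) d) * path_sum k i (i + d) =
      e_ind ^ ?r * strip_value k ?r (p - 1) d"
  proof (cases "d \<le> M")
    case False
    then show ?thesis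
      using specialise_beta_strip[OF p, of "Suc i" d] Suc.prems by (simp add: strip_value_def)
  next
    case True
    show ?thesis
    proof (cases "p = 1")
      case False
      then have row: "i + d = tri M + (p - 1)" "1 \<le> p - 1" "p - 1 \<le> Suc M" "p - 1 \<noteq> Suc M"
        using Suc.prems by auto
      then have "path_sum k i (i + d) = e_ind ^ ?r * strip_value k ?r (p - 1) d"
        using Suc.IH[OF row(1-3) Suc.prems(4)] by simp
      then show ?thesis
        using True False specialise_beta_strip[OF p, of "Suc i" d] Suc.prems by simp
    next
      case p1: True
      then have row: "i + d = tri M" using Suc.prems by simp
      \<comment> \<open>Row \<open>tri M\<close> is the sink's own row if \<open>M = k\<close>, with
        the single variable \<open>c\<close>; otherwise it is the top row of the next strip.\<close>
      have "path_sum k i (i + d) = e_ind ^ (M - k) * top_value k ?r d"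
      proof (cases "M = k")
        case True
        have "path_sum k i (i + d) = c_ind ^ (k - d)"
          using path_sum_at[of i k] row True by (metis add_diff_cancel_left' le_add1)
        then show ?thesis
          using True \<open>d \<le> M\<close> by (simp add: top_value_def hom_prog_one)
      next
        case False
        then obtain M' where "M = Suc M'" "k \<le> M'"
          using Suc.prems(4) by (cases M) auto
        then show ?thesis
          using Suc.IH[of d M' "Suc M'"] row by (simp add: Suc_diff_le)
      qed
      then show ?thesis
        using True p1 specialise_beta_strip[OF p, of "Suc i" d] Suc.prems
        by (simp add: strip_value_bottom Suc_diff_le)
    qed
  qed
  show ?case
  proof (cases "p = Suc M")
    case True
    then show ?thesis
      unfolding steps horizontal diagonal
      using top_value_Suc[OF Suc.prems(4), of d] by (simp add: distrib_left)
  next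
    case False
    obtain q where "p = Suc q" using p by (cases p) auto
    then show ?thesis
      unfolding steps horizontal diagonal
      using False strip_value_Suc[of k ?r q d] by (simp add: distrib_left less_Suc_eq_le)
  qed
qed

theorem theorem3p2:
  shows "(\<lambda>n k. specialise (path_matrix n k)) =
         (\<lambda>n k. rec_matrix a_ind c_ind e_ind n (int k))"
proof (intro ext)
  fix n k :: nat
  consider "n < k" | "n = k" | "k < n" by linarith
  then have "path_sum k (tri n) (tri n) =
      (if k \<le> n then e_ind ^ (n - k) * hom_prog a_ind c_ind (Suc (n - k)) k else 0)"
  proof cases
    case 1
    then show ?thesis by (simp add: path_sum_below tri_less_iff)
  next
    case 2
    then show ?thesis using path_sum_at[of "tri k" k] by (simp add: hom_prog_one)
  next
    case 3
    \<comment> \<open>The source lies on the diagonal, \<open>d = 0\<close>, in the top row of strip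
      \<open>M\<close>.\<close>
    then obtain M where "n = Suc M" "k \<le> M" by (cases n) auto
    then show ?thesis
      using path_sum_strip[of "tri n" 0 M "Suc M" k] by (simp add: top_value_def)
  qed
  then show "specialise (path_matrix n k) = rec_matrix a_ind c_ind e_ind n (int k)"
    by (simp only: specialise_path_matrix rec_matrix_closed_form)
qed

end
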